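(* For all integers $n,m\ge 0$, $$w_{n+m}(x)=\sum_{k=0}^{m}\sum_{j=0}^{n}\sum_{i=0}^{j}\genfrac{\{}{\}}{0pt}{}{m}{k}\binom{n}{j}\genfrac{\{}{\}}{0pt}{}{j}{i}\,k^{\,n-j}\,(i+k)!\,x^{i+k}$$ as polynomials in $x$.
   Context: The geometric polynomials are $w_n(x)=\sum_{k=0}^{n}\genfrac{\{}{\}}{0pt}{}{n}{k}k!\,x^k$, where $\genfrac{\{}{\}}{0pt}{}{n}{k}$ are the Stirling numbers of the second kind. Convention: $0^0=1$. *)

theory Defs
  imports "HOL-Combinatorics.Stirling" "HOL-Computational_Algebra.Polynomial"
begin

text \<open>
  The coefficients of the geometric polynomials are natural numbers, so the polynomials are
  defined over an arbitrary commutative semiring. The library constant \<^const>\<open>Stirling\<close>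
  denotes the Stirling numbers of the second kind.
\<close>

definition geometric_poly :: "nat \<Rightarrow> 'a::comm_semiring_1 poly" where
  "geometric_poly n = (\<Sum>k\<le>n. monom (of_nat (Stirling n k * fact k)) k)"

end

theory Submission
  imports Defs
begin

text \<open>
  Let \<open>A\<close> be the operator \<open>(A f) k = k f(k) + f(k+1)\<close> on sequences. The recurrence of the Stirling
  numbers says that \<open>(A\<^sup>n f)(0) = \<Sum>\<^sub>k S(n,k) f(k)\<close>, so \<open>w\<^sub>n = (A\<^sup>n f)(0)\<close> for \<open>f(k) = k! x\<^sup>k\<close>.
  Conjugating \<open>A\<close> with the shift by \<open>k\<close> gives \<open>k + A\<close>, whose powers the binomial theorem expands in
  those of \<open>A\<close>. Applying this to \<open>A\<^sup>n\<close> in \<open>w\<^sub>n\<^sub>+\<^sub>m = (A\<^sup>m (A\<^sup>n f))(0)\<close> yields the formula.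
\<close>

definition stirling_op :: "(nat \<Rightarrow> 'a::comm_semiring_1) \<Rightarrow> nat \<Rightarrow> 'a" where
  "stirling_op f k = of_nat k * f k + f (Suc k)"

text \<open>The recurrence of the Stirling numbers is moved onto \<open>f\<close>:
  \<open>stirling_op\<close> is its transpose.\<close>

lemma sum_Stirling_Suc:
  fixes f :: "nat \<Rightarrow> 'a::comm_semiring_1"
  shows "(\<Sum>k\<le>Suc n. of_nat (Stirling (Suc n) k) * f k) =
    (\<Sum>k\<le>n. of_nat (Stirling n k) * stirling_op f k)"
proof -
  have "(\<Sum>k\<le>Suc n. of_nat (Stirling (Suc n) k) * f k) =
      (\<Sum>k\<le>n. of_nat (Stirling (Suc n) (Suc k)) * f (Suc k))"
    by (subst sum.atMost_Suc_shift) simp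
  also have "\<dots> = (\<Sum>k\<le>n. of_nat (Stirling n (Suc k)) * (of_nat (Suc k) * f (Suc k)))
      + (\<Sum>k\<le>n. of_nat (Stirling n k) * f (Suc k))"
    unfolding sum.distrib [symmetric] by (intro sum.cong) (simp_all add: algebra_simps)
  \<comment> \<open>The new term at 0 vanishes through its factor \<open>of_nat k\<close>; the top
    term, dropped next, vanishes since \<open>Stirling n (Suc n) = 0\<close>.\<close>
  also have "(\<Sum>k\<le>n. of_nat (Stirling n (Suc k)) * (of_nat (Suc k) * f (Suc k))) =
      (\<Sum>k\<le>Suc n. of_nat (Stirling n k) * (of_nat k * f k))"
    by (subst sum.atMost_Suc_shift) simp
  also have "\<dots> = (\<Sum>k\<le>n. of_nat (Stirling n k) * (of_nat k * f k))"
    by simp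
  finally show ?thesis
    by (simp add: stirling_op_def distrib_left sum.distrib)
qed

lemma stirling_op_funpow_0:
  fixes f :: "nat \<Rightarrow> 'a::comm_semiring_1"
  shows "(stirling_op ^^ n) f 0 = (\<Sum>k\<le>n. of_nat (Stirling n k) * f k)"
  by (induction n arbitrary: f) (simp_all only: funpow_Suc_right o_apply sum_Stirling_Suc, simp)

text \<open>Pascal's rule gives this induction step of the binomial theorem, with \<open>a j\<close>
  in place of the \<open>j\<close>-th power of an operator.\<close>

lemma sum_binomial_Suc:
  fixes a :: "nat \<Rightarrow> 'a::comm_semiring_1"
  shows "(\<Sum>j\<le>Suc n. of_nat (Suc n choose j) * c ^ (Suc n - j) * a j) =
    c * (\<Sum>j\<le>n. of_nat (n choose j) * c ^ (n - j) * a j)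
    + (\<Sum>j\<le>n. of_nat (n choose j) * c ^ (n - j) * a (Suc j))"
proof -
  have "(\<Sum>j\<le>Suc n. of_nat (Suc n choose j) * c ^ (Suc n - j) * a j) =
      c ^ Suc n * a 0 + (\<Sum>j\<le>n. of_nat (n choose Suc j) * c ^ (n - j) * a (Suc j))
      + (\<Sum>j\<le>n. of_nat (n choose j) * c ^ (n - j) * a (Suc j))"
    by (subst sum.atMost_Suc_shift) (simp add: algebra_simps sum.distrib)
  also have "c ^ Suc n * a 0 + (\<Sum>j\<le>n. of_nat (n choose Suc j) * c ^ (n - j) * a (Suc j)) =
      (\<Sum>j\<le>Suc n. of_nat (n choose j) * c ^ (Suc n - j) * a j)"
    by (subst sum.atMost_Suc_shift) simp
  also have "\<dots> = c * (\<Sum>j\<le>n. of_nat (n choose j) * c ^ (n - j) * a j)"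
    by (simp add: sum_distrib_left binomial_eq_0 Suc_diff_le algebra_simps)
  finally show ?thesis .
qed

lemma stirling_op_funpow_shift:
  fixes f :: "nat \<Rightarrow> 'a::comm_semiring_1"
  shows "(stirling_op ^^ n) f (i + k) =
    (\<Sum>j\<le>n. of_nat (n choose j) * of_nat k ^ (n - j) * (stirling_op ^^ j) (\<lambda>l. f (l + k)) i)"
proof (induction n arbitrary: i)
  case (Suc n)
  let ?a = "\<lambda>j. (stirling_op ^^ j) (\<lambda>l. f (l + k))"
  let ?c = "\<lambda>j. of_nat (n choose j) * of_nat k ^ (n - j) :: 'a"
  have "(stirling_op ^^ Suc n) f (i + k) =
      of_nat (i + k) * (stirling_op ^^ n) f (i + k) + (stirling_op ^^ n) f (Suc i + k)"
    by (simp add: stirling_op_def)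
  also have "\<dots> = of_nat (i + k) * (\<Sum>j\<le>n. ?c j * ?a j i) + (\<Sum>j\<le>n. ?c j * ?a j (Suc i))"
    unfolding Suc.IH ..
  \<comment> \<open>The part \<open>of_nat i\<close> of the factor joins the values at
    \<open>Suc i\<close> to form one more application of \<open>stirling_op\<close>;
    \<open>of_nat k\<close> stays as the scalar.\<close>
  also have "\<dots> = of_nat k * (\<Sum>j\<le>n. ?c j * ?a j i) + (\<Sum>j\<le>n. ?c j * ?a (Suc j) i)"
    by (simp add: stirling_op_def sum_distrib_left sum.distrib algebra_simps)
  finally show ?case
    by (simp only: sum_binomial_Suc)
qed simp

lemma sum_Stirling_add:
  fixes f :: "nat \<Rightarrow> 'a::comm_semiring_1"
  shows "(\<Sum>k\<le>n + m. of_nat (Stirling (n + m) k) * f k) =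
    (\<Sum>k\<le>m. \<Sum>j\<le>n. \<Sum>i\<le>j.
      of_nat (Stirling m k * (n choose j) * Stirling j i * k ^ (n - j)) * f (i + k))"
proof -
  have "(\<Sum>k\<le>n + m. of_nat (Stirling (n + m) k) * f k) =
      (stirling_op ^^ m) ((stirling_op ^^ n) f) 0"
    by (simp add: stirling_op_funpow_0 [symmetric] add.commute [of n] funpow_add)
  \<comment> \<open>Writing \<open>0 + k\<close> lets the shift lemma apply at \<open>i = 0\<close>,
    where the inner powers are again Stirling sums.\<close>
  also have "\<dots> = (\<Sum>k\<le>m. of_nat (Stirling m k) * (stirling_op ^^ n) f (0 + k))"
    by (simp add: stirling_op_funpow_0)
  also have "\<dots> = (\<Sum>k\<le>m. \<Sum>j\<le>n. \<Sum>i\<le>j.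
      of_nat (Stirling m k * (n choose j) * Stirling j i * k ^ (n - j)) * f (i + k))"
    unfolding stirling_op_funpow_shift stirling_op_funpow_0
    by (simp add: sum_distrib_left mult_ac)
  finally show ?thesis .
qed

theorem corollary9:
  fixes n m :: nat
  shows "(geometric_poly (n + m) :: 'a::comm_semiring_1 poly) =
    (\<Sum>k\<le>m. \<Sum>j\<le>n. \<Sum>i\<le>j.
      monom (of_nat (Stirling m k * (n choose j) * Stirling j i * k ^ (n - j) * fact (i + k))) (i + k))"
proof -
  \<comment> \<open>Splitting off \<open>c\<close> brings both sides to the form of
    \<open>sum_Stirling_add\<close> with \<open>f l = monom (of_nat (fact l)) l\<close>.\<close>
  have monom: "monom (of_nat (c * fact l)) l = of_nat c * (monom (of_nat (fact l)) l :: 'a poly)"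
    for c l :: nat
    by (simp add: of_nat_poly smult_monom)
  show ?thesis
    unfolding geometric_poly_def monom by (rule sum_Stirling_add)
qed

end
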